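(* In the stochastic optimal control problem under a parameterized policy, let $\pi=(\theta_0^*,\dots,\theta_{n-1}^* )\in\Theta^n$ be a local minimizer of DP. Then $\pi$ is also a local minimizer of the one-shot optimization.
   Context: Setting (stochastic, parameterized policy): horizon $n$; on a complete probability space $(\Omega,\mathcal{F},\mathbb{P})$, $x_0$ is an $\mathbb{R}^N$-valued random variable with distribution $\rho$, and $w_0,\dots,w_{n-1}$ are $\mathbb{R}^W$-valued random variables, with $x_0,w_0,\dots,w_{n-1}$ mutually independent. The action space $A\subseteq\mathbb{R}^M$ is compact; dynamics $f_k:\mathbb{R}^N\times A\times\mathbb{R}^W\to\mathbb{R}^N$, stage costs $c_k:\mathbb{R}^N\times\mathbb{R}^M\to\mathbb{R}$ ($k=0,\dots,n-1$) and terminal cost $c_n:\mathbb{R}^N\to\mathbb{R}$ are at least twice continuously differentiable. $\Theta$ is a parameter space (a subset of a Euclidean space), and for each $\theta\in\Theta$, $\mu_\theta:\mathbb{R}^N\to A$ is a bounded function, such that for all $\epsilon>0$ there is $\delta>0$ with: $\|\theta-\theta'\|<\delta\Rightarrow\sup_{x\in\mathbb{R}^N}\|\mu_\theta(x)-\mu_{\theta'}(x)\|<\epsilon$. $B(c,r)$ denotes the open ball with center $c$ and radius $r$. For $\pi=(\theta_0,\dots,\theta_{n-1})\in\Theta^n$, define backward $J_n^\pi(x)=c_n(x)$, $Q_k^\pi(x,u)=\mathbb{E}_{w_k}[c_k(x,u)+J_{k+1}^\pi(f_k(x,u,w_k))]$, $J_k^\pi(x)=Q_k^\pi(x,\mu_{\theta_k}(x))$,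 $k=n-1,\dots,0$. The one-shot optimization is $\min_{\pi\in\Theta^n}\mathbb{E}_{x_0}[J_0^\pi(x_0)]$. Standing assumption: this is equivalent to minimizing $\mathbb{E}_{x_0,w_0,\dots,w_{n-1}}[\sum_{i=0}^{n-1}c_i(x_i,\mu_{\theta_i}(x_i))+c_n(x_n)]$ with $x_{i+1}=f_i(x_i,\mu_{\theta_i}(x_i),w_i)$, i.e. these expectations are well defined and the two objectives coincide (as holds, e.g., when the costs are uniformly bounded). Local minimizer of the one-shot optimization: $\pi=(\theta_0^*,\dots,\theta_{n-1}^* )\in\Theta^n$ such that for some $\epsilon>0$, $\mathbb{E}_{x_0}[J_0^\pi(x_0)]\le\mathbb{E}_{x_0}[J_0^{\tilde\pi}(x_0)]$ for all $\tilde\pi\in(B(\theta_0^*,\epsilon)\cap\Theta)\times\dots\times(B(\theta_{n-1}^*,\epsilon)\cap\Theta)$. Local minimizer of DP: $\pi=(\theta_0^*,\dots,\theta_{n-1}^* )\in\Theta^n$ such that for every $k\in\{0,\dots,n-1\}$ there is $\epsilon_k^*>0$ (independent of $x$) with $Q_k^\pi(x,\mu_{\theta_k^*}(x))\le Q_k^\pi(x,\mu_{\tilde\theta}(x))$ for all $x\in\mathbb{R}^N$ and all $\tilde\theta\in B(\theta_k^*,\epsilon_k^* )\cap\Theta$. *)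

theory Defs
  imports "HOL-Probability.Probability"
begin

text \<open>
  On a set that need not be open, twice continuously differentiable means: the restriction of a
  twice continuously (Frechet) differentiable function on an open superset.
\<close>

definition C2_on :: "'a::real_normed_vector set \<Rightarrow> ('a \<Rightarrow> 'b::real_normed_vector) \<Rightarrow> bool" where
  "C2_on S f \<longleftrightarrow>
     (\<exists>U g (g' :: 'a \<Rightarrow> 'a \<Rightarrow>\<^sub>L 'b) (g'' :: 'a \<Rightarrow> 'a \<Rightarrow>\<^sub>L 'a \<Rightarrow>\<^sub>L 'b).
        open U \<and> S \<subseteq> U \<and> (\<forall>z\<in>S. g z = f z) \<and>
        (\<forall>z\<in>U. (g has_derivative blinfun_apply (g' z)) (at z)) \<and>
        (\<forall>z\<in>U. (g' has_derivative blinfun_apply (g'' z)) (at z)) \<and>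
        continuous_on U g'')"

locale control_data =
  fixes M :: "'a measure"
    and n :: nat
    and x0 :: "'a \<Rightarrow> real ^ 'N"
    and w :: "nat \<Rightarrow> 'a \<Rightarrow> real ^ 'W"
    and f :: "nat \<Rightarrow> real ^ 'N \<Rightarrow> real ^ 'M \<Rightarrow> real ^ 'W \<Rightarrow> real ^ 'N"
    and c :: "nat \<Rightarrow> real ^ 'N \<Rightarrow> real ^ 'M \<Rightarrow> real"
    and c_final :: "real ^ 'N \<Rightarrow> real"
    and \<Theta> :: "(real ^ 'P) set"
    and \<mu> :: "real ^ 'P \<Rightarrow> real ^ 'N \<Rightarrow> real ^ 'M"
begin

definition params :: "(nat \<Rightarrow> real ^ 'P) set" where
  "params = {..<n} \<rightarrow>\<^sub>E \<Theta>"

text \<open>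
  \<open>Q\<close> is meaningful for stages \<open>k < n\<close> and \<open>J\<close> for \<open>k \<le> n\<close>.
\<close>

function Q :: "(nat \<Rightarrow> real ^ 'P) \<Rightarrow> nat \<Rightarrow> real ^ 'N \<Rightarrow> real ^ 'M \<Rightarrow> real"
  and J :: "(nat \<Rightarrow> real ^ 'P) \<Rightarrow> nat \<Rightarrow> real ^ 'N \<Rightarrow> real"
where
  "Q \<pi> k x u = (\<integral>\<omega>. c k x u + J \<pi> (Suc k) (f k x u (w k \<omega>)) \<partial>M)"
| "J \<pi> k x = (if k < n then Q \<pi> k x (\<mu> (\<pi> k) x) else c_final x)"
  by pat_completeness auto
termination
  by (relation "Wellfounded.measure (case_sum (\<lambda>(\<pi>, k, x, u). Suc (2 * (n - Suc k))) (\<lambda>(\<pi>, k, x). 2 * (n - k)))")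
    auto

declare Q.simps [simp del] J.simps [simp del]

primrec trajectory :: "(nat \<Rightarrow> real ^ 'P) \<Rightarrow> nat \<Rightarrow> 'a \<Rightarrow> real ^ 'N" where
  "trajectory \<pi> 0 \<omega> = x0 \<omega>"
| "trajectory \<pi> (Suc i) \<omega> =
     f i (trajectory \<pi> i \<omega>) (\<mu> (\<pi> i) (trajectory \<pi> i \<omega>)) (w i \<omega>)"

definition total_cost :: "(nat \<Rightarrow> real ^ 'P) \<Rightarrow> 'a \<Rightarrow> real" where
  "total_cost \<pi> \<omega> =
     (\<Sum>i<n. c i (trajectory \<pi> i \<omega>) (\<mu> (\<pi> i) (trajectory \<pi> i \<omega>))) + c_final (trajectory \<pi> n \<omega>)"

definition one_shot_objective :: "(nat \<Rightarrow> real ^ 'P) \<Rightarrow> real" where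
  "one_shot_objective \<pi> = (\<integral>\<omega>. J \<pi> 0 (x0 \<omega>) \<partial>M)"

definition one_shot_local_minimizer :: "(nat \<Rightarrow> real ^ 'P) \<Rightarrow> bool" where
  "one_shot_local_minimizer \<pi> \<longleftrightarrow> \<pi> \<in> params \<and>
     (\<exists>\<epsilon>>0. \<forall>\<pi>' \<in> (\<Pi>\<^sub>E k\<in>{..<n}. ball (\<pi> k) \<epsilon> \<inter> \<Theta>).
        one_shot_objective \<pi> \<le> one_shot_objective \<pi>')"

definition DP_local_minimizer :: "(nat \<Rightarrow> real ^ 'P) \<Rightarrow> bool" where
  "DP_local_minimizer \<pi> \<longleftrightarrow> \<pi> \<in> params \<and>
     (\<forall>k<n. \<exists>\<epsilon>>0. \<forall>x. \<forall>\<theta> \<in> ball (\<pi> k) \<epsilon> \<inter> \<Theta>.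
        Q \<pi> k x (\<mu> (\<pi> k) x) \<le> Q \<pi> k x (\<mu> \<theta> x))"

end

text \<open>
  Since the initial state and the noise take values in different types, \<^const>\<open>prob_space.indep_vars\<close>
  cannot be applied to them jointly; mutual independence is stated for the generated sigma-algebras,
  with index \<open>0\<close> for the initial state and \<open>Suc k\<close> for the noise at stage \<open>k\<close>.

  The Bochner integral of a non-integrable function is \<open>0\<close>, so the requirement that the
  expectations be well defined appears as explicit integrability assumptions. They are also
  what makes the integrands measurable, as \<open>\<mu> \<theta>\<close> need not be Borel.
\<close>

locale stochastic_control =
  control_data M n x0 w f c c_final \<Theta> \<mu> + prob_space M + complete_measure M
  for M :: "'a measure"
    and n :: nat
    and x0 :: "'a \<Rightarrow> real ^ 'N"
    and w :: "nat \<Rightarrow> 'a \<Rightarrow> real ^ 'W"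
    and f :: "nat \<Rightarrow> real ^ 'N \<Rightarrow> real ^ 'M \<Rightarrow> real ^ 'W \<Rightarrow> real ^ 'N"
    and c :: "nat \<Rightarrow> real ^ 'N \<Rightarrow> real ^ 'M \<Rightarrow> real"
    and c_final :: "real ^ 'N \<Rightarrow> real"
    and \<Theta> :: "(real ^ 'P) set"
    and \<mu> :: "real ^ 'P \<Rightarrow> real ^ 'N \<Rightarrow> real ^ 'M" +
  fixes \<rho> :: "(real ^ 'N) measure"
    and A :: "(real ^ 'M) set"
  assumes x0_random: "random_variable borel x0"
    and x0_distr: "distr M borel x0 = \<rho>"
    and w_random: "\<And>k. k < n \<Longrightarrow> random_variable borel (w k)"
    and indep: "indep_sets
      (case_nat {x0 -` B \<inter> space M | B. B \<in> sets borel}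
        (\<lambda>k. {w k -` B \<inter> space M | B. B \<in> sets borel})) {..n}"
    and compact_A: "compact A"
    and f_C2: "\<And>k. k < n \<Longrightarrow> C2_on (UNIV \<times> A \<times> UNIV) (\<lambda>(x, u, v). f k x u v)"
    and c_C2: "\<And>k. k < n \<Longrightarrow> C2_on UNIV (\<lambda>(x, u). c k x u)"
    and c_final_C2: "C2_on UNIV c_final"
    and mu_range: "\<And>\<theta> x. \<theta> \<in> \<Theta> \<Longrightarrow> \<mu> \<theta> x \<in> A"
    and mu_bounded: "\<And>\<theta>. \<theta> \<in> \<Theta> \<Longrightarrow> bounded (range (\<mu> \<theta>))"
    and mu_continuous: "\<And>\<epsilon>. \<epsilon> > 0 \<Longrightarrow> \<exists>\<delta>>0. \<forall>\<theta>\<in>\<Theta>. \<forall>\<theta>'\<in>\<Theta>.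
      norm (\<theta> - \<theta>') < \<delta> \<longrightarrow> (SUP x. norm (\<mu> \<theta> x - \<mu> \<theta>' x)) < \<epsilon>"
    and integrable_stage: "\<And>\<pi> k x. \<pi> \<in> params \<Longrightarrow> k < n \<Longrightarrow>
      integrable M (\<lambda>\<omega>. c k x (\<mu> (\<pi> k) x) + J \<pi> (Suc k) (f k x (\<mu> (\<pi> k) x) (w k \<omega>)))"
    and integrable_initial: "\<And>\<pi>. \<pi> \<in> params \<Longrightarrow> integrable M (\<lambda>\<omega>. J \<pi> 0 (x0 \<omega>))"
    and integrable_total: "\<And>\<pi>. \<pi> \<in> params \<Longrightarrow> integrable M (total_cost \<pi>)"
    and objectives_eq: "\<And>\<pi>. \<pi> \<in> params \<Longrightarrow> one_shot_objective \<pi> = (\<integral>\<omega>. total_cost \<pi> \<omega> \<partial>M)"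

end

theory Submission
  imports Defs
begin

text \<open>
  Backward induction on the stage shows that \<open>J \<pi> k \<le> J \<pi>' k\<close> pointwise for every \<open>\<pi>'\<close> close to a
  local minimizer \<open>\<pi>\<close> of DP: first change only the current parameter (local optimality of the
  stage), then the cost-to-go (monotonicity of the expectation). The neighbourhood is uniform in
  the state, so integrating over the initial state gives the claim.
\<close>

text \<open>The recursion only looks forward: stage \<open>k\<close> refers to the parameters from
  \<open>k\<close> on. Hence the parameter of one stage can be replaced without disturbing the
  costs-to-go after it.\<close>

lemma (in control_data) J_cong:
  assumes "\<And>j. k \<le> j \<Longrightarrow> j < n \<Longrightarrow> \<pi> j = \<pi>' j"
  shows "J \<pi> k x = J \<pi>' k x"
  using assms
proof (induction "n - k" arbitrary: k x)
  \<comment> \<open>By truncated subtraction this covers every k \<ge> n, where \<open>J\<close> is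
    the terminal cost for any parameters.\<close>
  case 0
  then show ?case
    by (simp add: J.simps)
next
  case (Suc m)
  then have "J \<pi> (Suc k) y = J \<pi>' (Suc k) y" for y
    by (intro Suc.hyps(1)) auto
  moreover have "k < n" "\<pi> k = \<pi>' k"
    using Suc by auto
  ultimately show ?case
    by (simp add: J.simps[of _ k] Q.simps)
qed

context stochastic_control
begin

text \<open>Changing the parameter of stage \<open>k\<close> leaves the later costs-to-go unchanged, so the
  integrability assumption also applies when \<open>\<theta>\<close> is not the parameter prescribed by \<open>\<pi>\<close>.\<close>

lemma integrable_Q:
  assumes "\<pi> \<in> params" "k < n" "\<theta> \<in> \<Theta>"
  shows "integrable M (\<lambda>\<omega>. c k x (\<mu> \<theta> x) + J \<pi> (Suc k) (f k x (\<mu> \<theta> x) (w k \<omega>)))"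
proof -
  have "\<pi>(k := \<theta>) \<in> params"
    using assms by (auto simp: params_def PiE_iff extensional_def)
  moreover have "J (\<pi>(k := \<theta>)) (Suc k) y = J \<pi> (Suc k) y" for y
    by (rule J_cong) auto
  ultimately show ?thesis
    using integrable_stage[of "\<pi>(k := \<theta>)" k x] assms by simp
qed

lemma J_mono_if_stagewise_optimal:
  assumes "\<pi> \<in> params" "\<pi>' \<in> params"
    and "\<And>k x. k < n \<Longrightarrow> Q \<pi> k x (\<mu> (\<pi> k) x) \<le> Q \<pi> k x (\<mu> (\<pi>' k) x)"
  shows "J \<pi> k x \<le> J \<pi>' k x"
proof (induction "n - k" arbitrary: k x)
  case 0
  then show ?case
    by (simp add: J.simps)
next
  case (Suc m)
  then have "k < n" and IH: "J \<pi> (Suc k) y \<le> J \<pi>' (Suc k) y" for y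
    by simp_all
  have "\<pi>' k \<in> \<Theta>"
    using assms(2) \<open>k < n\<close> by (auto simp: params_def)
  have "J \<pi> k x \<le> Q \<pi> k x (\<mu> (\<pi>' k) x)"
    using assms(3) \<open>k < n\<close> by (simp add: J.simps)
  \<comment> \<open>Both sides take the same action, so only the costs-to-go differ. Both integrands
    must be integrable: the default integral 0 could break monotonicity.\<close>
  also have "\<dots> \<le> Q \<pi>' k x (\<mu> (\<pi>' k) x)"
    unfolding Q.simps using assms(1,2) \<open>k < n\<close> \<open>\<pi>' k \<in> \<Theta>\<close>
    by (intro integral_mono integrable_Q add_left_mono IH)
  also have "\<dots> = J \<pi>' k x"
    using \<open>k < n\<close> by (simp add: J.simps)
  finally show ?case .
qed

lemma DP_local_minimizer_imp_one_shot_local_minimizer: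
  assumes "DP_local_minimizer \<pi>"
  shows "one_shot_local_minimizer \<pi>"
proof -
  have \<pi>: "\<pi> \<in> params"
    using assms by (simp add: DP_local_minimizer_def)
  obtain e where e: "\<And>k. k < n \<Longrightarrow> e k > 0"
    and opt: "\<And>k x \<theta>. k < n \<Longrightarrow> \<theta> \<in> ball (\<pi> k) (e k) \<inter> \<Theta> \<Longrightarrow>
      Q \<pi> k x (\<mu> (\<pi> k) x) \<le> Q \<pi> k x (\<mu> \<theta> x)"
    using assms unfolding DP_local_minimizer_def by metis
  \<comment> \<open>Finitely many stages leave a positive common radius; the 1 keeps the set
    nonempty when \<open>n = 0\<close>.\<close>
  define \<epsilon> where "\<epsilon> = Min (insert 1 (e ` {..<n}))"
  have \<epsilon>_le: "\<epsilon> \<le> e k" if "k < n" for k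
    using that by (auto simp: \<epsilon>_def)
  have "\<epsilon> > 0"
    using e by (auto simp: \<epsilon>_def)
  moreover have "one_shot_objective \<pi> \<le> one_shot_objective \<pi>'"
    if near: "\<pi>' \<in> (\<Pi>\<^sub>E k\<in>{..<n}. ball (\<pi> k) \<epsilon> \<inter> \<Theta>)" for \<pi>'
  proof -
    have \<pi>': "\<pi>' \<in> params"
      using near by (auto simp: params_def)
    have "\<pi>' k \<in> ball (\<pi> k) (e k) \<inter> \<Theta>" if "k < n" for k
      using PiE_mem[OF near, of k] subset_ball[OF \<epsilon>_le[OF that], of "\<pi> k"] that by blast
    then have "J \<pi> 0 x \<le> J \<pi>' 0 x" for x
      by (intro J_mono_if_stagewise_optimal \<pi> \<pi>' opt)
    then show ?thesis
      unfolding one_shot_objective_def by (intro integral_mono integrable_initial \<pi> \<pi>')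
  qed
  ultimately show ?thesis
    using \<pi> unfolding one_shot_local_minimizer_def by blast
qed

end

theorem theorem7:
  fixes M :: "'a measure"
    and n :: nat
    and x0 :: "'a \<Rightarrow> real ^ 'N"
    and w :: "nat \<Rightarrow> 'a \<Rightarrow> real ^ 'W"
    and f :: "nat \<Rightarrow> real ^ 'N \<Rightarrow> real ^ 'M \<Rightarrow> real ^ 'W \<Rightarrow> real ^ 'N"
    and c :: "nat \<Rightarrow> real ^ 'N \<Rightarrow> real ^ 'M \<Rightarrow> real"
    and c_final :: "real ^ 'N \<Rightarrow> real"
    and \<Theta> :: "(real ^ 'P) set"
    and \<mu> :: "real ^ 'P \<Rightarrow> real ^ 'N \<Rightarrow> real ^ 'M"
    and \<rho> :: "(real ^ 'N) measure"
    and A :: "(real ^ 'M) set"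
    and \<pi> :: "nat \<Rightarrow> real ^ 'P"
  assumes "stochastic_control M n x0 w f c c_final \<Theta> \<mu> \<rho> A"
    and "control_data.DP_local_minimizer M n w f c c_final \<Theta> \<mu> \<pi>"
  shows "control_data.one_shot_local_minimizer M n x0 w f c c_final \<Theta> \<mu> \<pi>"
  using assms by (rule stochastic_control.DP_local_minimizer_imp_one_shot_local_minimizer)

end
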